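(* Let $P\subseteq\mathbb{R}^2$ with $|P|=9$ be shattered by $\mathcal{F}_3$ and contain no four collinear points. Then $P$ satisfies: (O) $P$ is covered by at most three lines; (B1) for every choice of lines $L_1,\dots,L_{m_P}$ covering $P$ and every $x\in P$, $x$ is contained in exactly two cross-lines with respect to $P$ and $\{L_1,\dots,L_{m_P}\}$; (B2) for every choice of lines $L_1,\dots,L_{m_P}$ covering $P$, there exist $y\in P$, two distinct $y$-cross-lines $l_y,l_y'$, and a cross-line $l$ with $y\notin l$ such that $l\cap l_y\cap P\neq\emptyset$ and $l\cap l_y'\cap P\neq\emptyset$ (all cross-lines with respect to $P$ and $\{L_1,\dots,L_{m_P}\}$).
   Context: $\mathcal{F}_3$ is the family of all unions of three lines in $\mathbb{R}^2$; it shatters $P$ if every $Z\subseteq P$ equals $S\cap P$ for some $S\in\mathcal{F}_3$. $m_P$ is the minimal number of lines whose union contains $P$. Given $P$ and a set $\mathcal{S}$ of lines, a line $l$ is a cross-line with respect to $P$ and $\mathcal{S}$ if $|l\cap l'\cap P|=1$ for every $l'\in\mathcal{S}$; a $y$-cross-line is a cross-line containing $y$. *)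

theory Defs
  imports "HOL-Analysis.Analysis"
begin

type_synonym plane = "real ^ 2"

definition is_line :: "plane set \<Rightarrow> bool" where
  "is_line l \<longleftrightarrow> affine l \<and> aff_dim l = 1"

text \<open>The three lines are not required to be distinct.\<close>

definition F3 :: "plane set set" where
  "F3 = {A \<union> B \<union> C | A B C. is_line A \<and> is_line B \<and> is_line C}"

definition shatters :: "'a set set \<Rightarrow> 'a set \<Rightarrow> bool" where
  "shatters \<F> P \<longleftrightarrow> (\<forall>Z. Z \<subseteq> P \<longrightarrow> (\<exists>S\<in>\<F>. Z = S \<inter> P))"

definition lines_cover :: "plane set set \<Rightarrow> plane set \<Rightarrow> bool" where
  "lines_cover \<S> P \<longleftrightarrow> finite \<S> \<and> (\<forall>l\<in>\<S>. is_line l) \<and> P \<subseteq> \<Union>\<S>"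

text \<open>Meaningful when \<open>P\<close> has some finite cover by lines, in particular for every finite \<open>P\<close>.\<close>

definition min_lines :: "plane set \<Rightarrow> nat" where
  "min_lines P = (LEAST n. \<exists>\<S>. lines_cover \<S> P \<and> card \<S> = n)"

definition cross_line :: "plane set \<Rightarrow> plane set set \<Rightarrow> plane set \<Rightarrow> bool" where
  "cross_line P \<S> l \<longleftrightarrow> is_line l \<and> (\<forall>l'\<in>\<S>. card (l \<inter> l' \<inter> P) = 1)"

definition point_cross_line :: "plane set \<Rightarrow> plane set set \<Rightarrow> plane \<Rightarrow> plane set \<Rightarrow> bool" where
  "point_cross_line P \<S> y l \<longleftrightarrow> cross_line P \<S> l \<and> y \<in> l"

definition property_O :: "plane set \<Rightarrow> bool" where
  "property_O P \<longleftrightarrow> (\<exists>\<S>. lines_cover \<S> P \<and> card \<S> \<le> 3)"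

definition property_B1 :: "plane set \<Rightarrow> bool" where
  "property_B1 P \<longleftrightarrow>
    (\<forall>L :: nat \<Rightarrow> plane set. lines_cover (L ` {1..min_lines P}) P \<longrightarrow>
      (\<forall>x\<in>P. card {l. point_cross_line P (L ` {1..min_lines P}) x l} = 2))"

definition property_B2 :: "plane set \<Rightarrow> bool" where
  "property_B2 P \<longleftrightarrow>
    (\<forall>L :: nat \<Rightarrow> plane set. lines_cover (L ` {1..min_lines P}) P \<longrightarrow>
      (\<exists>y\<in>P. \<exists>ly ly' l.
         point_cross_line P (L ` {1..min_lines P}) y ly \<and>
         point_cross_line P (L ` {1..min_lines P}) y ly' \<and>
         ly \<noteq> ly' \<and>
         cross_line P (L ` {1..min_lines P}) l \<and>
         y \<notin> l \<and>
         l \<inter> ly \<inter> P \<noteq> {} \<and>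
         l \<inter> ly' \<inter> P \<noteq> {}))"

end

theory Submission
  imports Defs
begin

text \<open>
Three lines \<open>A\<close>, \<open>B\<close>, \<open>C\<close> covering \<open>P\<close> contain three points each, so a cross-line is a triple of
indices \<open>(i, j, k)\<close>, and the cross-lines form a partial Latin square of order 3: row \<open>i\<close>, column \<open>j\<close>,
symbol \<open>k\<close>. Besides \<open>P\<close> itself, two kinds of shattered subsets suffice.

Covering the complement of a point \<open>a\<^sub>i\<close> forces two disjoint cross-lines such that \<open>a\<^sub>i\<close> and the two
points left over are not collinear. Covering \<open>{a\<^sub>i, a\<^sub>i', b\<^sub>j, b\<^sub>j'}\<close> shows that the square has no filled
rectangle: two of the four points would lie on a common covering line, but each
of the six pairs spans a line through a point of \<open>P\<close> outside the set.

The two conditions make every row contain at least two entries; a full row would then give a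
rectangle, so every row, and by symmetry every column and symbol, occurs exactly twice. In the
graph of the six cross-lines, joined when they meet in \<open>P\<close>, every vertex has degree 3. Without a triangle
this graph is \<open>K\<^sub>3\<^sub>,\<^sub>3\<close> (the Pappus configuration), and then any two disjoint cross-lines leave over three
collinear points, which the first condition forbids.
\<close>

section \<open>Partial Latin squares of order 3\<close>

lemma distinct_3_cases:
  fixes i i1 i2 :: 3
  assumes "distinct [i, i1, i2]"
  shows "x = i \<or> x = i1 \<or> x = i2"
  using assms exhaust_3[of x] exhaust_3[of i] exhaust_3[of i1] exhaust_3[of i2] by auto

lemma distinct_3_pair:
  fixes i i1 i2 x y :: 3
  assumes "distinct [i, i1, i2]" "distinct [i, x, y]"
  shows "x = i1 \<and> y = i2 \<or> x = i2 \<and> y = i1"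
  using distinct_3_cases[OF assms(1), of x] distinct_3_cases[OF assms(1), of y] assms(2) by auto

lemma third_index: "i1 \<noteq> i2 \<Longrightarrow> \<exists>i::3. distinct [i, i1, i2]"
  using exhaust_3[of i1] exhaust_3[of i2] by (auto intro: exI[of _ 1] exI[of _ 2] exI[of _ 3])

lemma other_indices:
  fixes i :: 3
  obtains i1 i2 where "distinct [i, i1, i2]"
  using exhaust_3[of i] that[of 2 3] that[of 1 3] that[of 1 2] by auto

text \<open>The \<open>unique\<close> assumptions come from two points determining a line, the
  \<open>delete\<close> ones from covering all of \<open>P\<close> but one point, the
  \<open>rectangle\<close> ones from covering four points on two of the lines. Each family is listed
  for all three roles, which keeps the axioms symmetric.\<close>

locale cross_pattern =
  fixes T :: "3 \<Rightarrow> 3 \<Rightarrow> 3 \<Rightarrow> bool"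
  assumes unique_a: "T i j k \<Longrightarrow> T i' j k \<Longrightarrow> i = i'"
    and unique_b: "T i j k \<Longrightarrow> T i j' k \<Longrightarrow> j = j'"
    and unique_c: "T i j k \<Longrightarrow> T i j k' \<Longrightarrow> k = k'"
    and delete_a: "\<exists>i1 i2 j1 j2 j k1 k2 k. distinct [i, i1, i2] \<and> distinct [j, j1, j2] \<and>
      distinct [k, k1, k2] \<and> T i1 j1 k1 \<and> T i2 j2 k2 \<and> \<not> T i j k"
    and delete_b: "\<exists>j1 j2 i1 i2 i k1 k2 k. distinct [j, j1, j2] \<and> distinct [i, i1, i2] \<and>
      distinct [k, k1, k2] \<and> T i1 j1 k1 \<and> T i2 j2 k2 \<and> \<not> T i j k"
    and delete_c: "\<exists>k1 k2 i1 i2 i j1 j2 j. distinct [k, k1, k2] \<and> distinct [i, i1, i2] \<and>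
      distinct [j, j1, j2] \<and> T i1 j1 k1 \<and> T i2 j2 k2 \<and> \<not> T i j k"
    and rectangle_ab: "i \<noteq> i' \<Longrightarrow> j \<noteq> j' \<Longrightarrow> T i j k1 \<Longrightarrow> T i j' k2 \<Longrightarrow>
      T i' j k3 \<Longrightarrow> T i' j' k4 \<Longrightarrow> False"
    and rectangle_ac: "i \<noteq> i' \<Longrightarrow> k \<noteq> k' \<Longrightarrow> T i j1 k \<Longrightarrow> T i j2 k' \<Longrightarrow>
      T i' j3 k \<Longrightarrow> T i' j4 k' \<Longrightarrow> False"
    and rectangle_bc: "j \<noteq> j' \<Longrightarrow> k \<noteq> k' \<Longrightarrow> T i1 j k \<Longrightarrow> T i2 j k' \<Longrightarrow>
      T i3 j' k \<Longrightarrow> T i4 j' k' \<Longrightarrow> False"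
begin

text \<open>This and \<open>swap_ab\<close> generate all permutations of the roles, so facts about
  rows carry over to columns and symbols.\<close>

lemma swap_bc: "cross_pattern (\<lambda>i k j. T i j k)"
  apply unfold_locales
  subgoal using unique_a by blast
  subgoal using unique_c by blast
  subgoal using unique_b by blast
  subgoal for i using delete_a[of i] by blast
  subgoal for k using delete_c[of k] by blast
  subgoal for j using delete_b[of j] by blast
  subgoal using rectangle_ac by blast
  subgoal using rectangle_ab by blast
  subgoal using rectangle_bc by blast
  done

lemma swap_ab: "cross_pattern (\<lambda>j i k. T i j k)"
  apply unfold_locales
  subgoal using unique_b by blast
  subgoal using unique_a by blast
  subgoal using unique_c by blast
  subgoal for j using delete_b[of j] by blast
  subgoal for i using delete_a[of i] by blast
  subgoal for k using delete_c[of k] by blast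
  subgoal using rectangle_ab by blast
  subgoal using rectangle_bc by blast
  subgoal using rectangle_ac by blast
  done

section \<open>Number of entries in a row\<close>

lemma delete_a_ordered:
  assumes "distinct [i, i1, i2]"
  shows "\<exists>j1 j2 j k1 k2 k. distinct [j1, j2, j] \<and> distinct [k1, k2, k] \<and>
    T i1 j1 k1 \<and> T i2 j2 k2 \<and> \<not> T i j k"
proof -
  obtain ia ib j1 j2 j k1 k2 k where *: "distinct [i, ia, ib]" "distinct [j, j1, j2]"
    "distinct [k, k1, k2]" "T ia j1 k1" "T ib j2 k2" "\<not> T i j k"
    using delete_a[of i] by blast
  moreover have "distinct [j1, j2, j]" "distinct [j2, j1, j]" "distinct [k1, k2, k]" "distinct [k2, k1, k]"
    using * by auto
  ultimately show ?thesis using distinct_3_pair[OF assms *(1)] by blast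
qed

text \<open>
Up to exchanging columns and symbols, this is the pattern that the deletion condition for the other
two rows produces when row \<open>i\<close> has a single entry.
\<close>

lemma no_single_entry:
  assumes d: "distinct [i, i1, i2]" "distinct [j, j1, j2]" "distinct [k, k1, k2]"
    and T: "T i j k" "T i2 j1 k1" "T i1 j1 k2"
    and nT: "\<not> T i1 j2 k2" "\<not> T i2 j2 k1"
    and one: "\<And>j' k'. T i j' k' \<Longrightarrow> j' = j"
  shows False
proof -
  have one': "k' = k" "j' = j" if "T i j' k'" for j' k'
    using that one unique_c T(1) by blast+
  \<comment> \<open>Deletion at column \<open>j\<close> needs disjoint entries in columns
    \<open>j1\<close> and \<open>j2\<close>, both outside row \<open>i\<close>. The one in column
    \<open>j1\<close> is one of the two given; the one in column \<open>j2\<close> lies in the other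
    row, where \<open>nT\<close> leaves only the symbol \<open>k\<close>.\<close>
  have A: "T i2 j2 k \<or> T i1 j2 k"
  proof -
    obtain ja jb ia ib ic ka kb kc where
      *: "distinct [j,ja,jb]" "distinct [ic,ia,ib]" "distinct [kc,ka,kb]" "T ia ja ka" "T ib jb kb" "\<not> T ic j kc"
      using delete_b[of j] by blast
    have "(ja = j1 \<and> jb = j2) \<or> (ja = j2 \<and> jb = j1)" by (rule distinct_3_pair[OF d(2) *(1)])
    then show ?thesis
      using distinct_3_cases[OF d(1), of ia] distinct_3_cases[OF d(1), of ib]
        distinct_3_cases[OF d(3), of ka] distinct_3_cases[OF d(3), of kb] * d T nT one'
        unique_a unique_b unique_c by (smt (verit) distinct_length_2_or_more)
  qed
  \<comment> \<open>Deletion at symbol \<open>k\<close> needs disjoint entries with symbols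
    \<open>k1\<close> and \<open>k2\<close> in rows \<open>i1\<close> and \<open>i2\<close>. The
    leftover column is not \<open>j\<close>, since \<open>T i j k\<close> holds, so one of the
    entries uses column \<open>j\<close>; uniqueness against the given entries leaves these two
    placements.\<close>
  have B: "(T i1 j k1 \<and> T i2 j2 k2) \<or> (T i1 j2 k1 \<and> T i2 j k2)"
  proof -
    obtain ja jb jc ia ib ic ka kb where
      *: "distinct [k,ka,kb]" "distinct [ic,ia,ib]" "distinct [jc,ja,jb]" "T ia ja ka" "T ib jb kb" "\<not> T ic jc k"
      using delete_c[of k] by blast
    have "(ka = k1 \<and> kb = k2) \<or> (ka = k2 \<and> kb = k1)" by (rule distinct_3_pair[OF d(3) *(1)])
    then show ?thesis
      using distinct_3_cases[OF d(1), of ia] distinct_3_cases[OF d(1), of ib]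
        distinct_3_cases[OF d(2), of ja] distinct_3_cases[OF d(2), of jb] * d T nT one'
        unique_a unique_b unique_c by (smt (verit) distinct_length_2_or_more)
  qed
  \<comment> \<open>Each case of \<open>A\<close> is compatible with only one case of
    \<open>B\<close>, and then rows \<open>i1\<close>, \<open>i2\<close> and columns
    \<open>j1\<close>, \<open>j2\<close> are filled.\<close>
  show False
    using A B rectangle_ab[of i1 i2 j1 j2] T d unique_c by (metis distinct_length_2_or_more)
qed

lemma degree_ge_2: "\<exists>j j' k k'. j \<noteq> j' \<and> T i j k \<and> T i j' k'"
proof (rule ccontr)
  assume "\<not> ?thesis"
  then have one: "j = j'" if "T i j k" "T i j' k'" for j j' k k' using that by blast
  obtain i1 i2 where d: "distinct [i, i1, i2]" using delete_a[of i] by blast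
  then have d1: "distinct [i1, i, i2]" and d2: "distinct [i2, i, i1]" by auto
  obtain j j1 j2 k k1 k2 where dl: "distinct [j, j1, j2]" "distinct [k, k1, k2]"
    and l: "T i j k" "T i2 j1 k1" "\<not> T i1 j2 k2"
    using delete_a_ordered[OF d1] by blast
  obtain ja jb jc ka kb kc where dm: "distinct [ja, jb, jc]" "distinct [ka, kb, kc]"
    and m: "T i ja ka" "T i1 jb kb" "\<not> T i2 jc kc"
    using delete_a_ordered[OF d2] by blast
  \<comment> \<open>Deletion at \<open>i1\<close> and deletion at \<open>i2\<close> both use an
    entry of row \<open>i\<close>, hence the same one.\<close>
  have "ja = j" "ka = k" using one m l unique_c by blast+
  have "jb = j1 \<and> jc = j2 \<or> jb = j2 \<and> jc = j1" "kb = k1 \<and> kc = k2 \<or> kb = k2 \<and> kc = k1"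
    using dm dl \<open>ja = j\<close> \<open>ka = k\<close> distinct_3_pair[OF dl(1), of jb jc] distinct_3_pair[OF dl(2), of kb kc] by blast+
  moreover have "i1 \<noteq> i2" using d by auto
  \<comment> \<open>Agreement in both column and symbol would repeat \<open>(j1, k1)\<close> in two
    rows; disagreement in both is the triple excluded by deletion at \<open>i1\<close>. The two
    mixed cases are exchanged by \<open>swap_bc\<close>.\<close>
  ultimately consider "jb = j1" "jc = j2" "kb = k2" "kc = k1" | "jb = j2" "jc = j1" "kb = k1" "kc = k2"
    using l m unique_a by blast
  then show False
  proof cases
    case 1
    then show False using no_single_entry[of i i1 i2 j j1 j2 k k1 k2] d dl l m one by blast
  next
    case 2
    interpret s: cross_pattern "\<lambda>i k j. T i j k" by (rule swap_bc)
    have "k' = k" if "T i j' k'" for j' k'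
      using one that l unique_c by blast
    then show False using s.no_single_entry[of i i1 i2 k k1 k2 j j1 j2] d dl l m 2 by blast
  qed
qed

lemma degree_eq_2:
  "\<exists>j j' k k'. j \<noteq> j' \<and> T i j k \<and> T i j' k' \<and>
    (\<forall>x y. T i x y \<longrightarrow> (x, y) = (j, k) \<or> (x, y) = (j', k'))"
proof -
  obtain j j' k k' where j: "j \<noteq> j'" "T i j k" "T i j' k'" using degree_ge_2 by blast
  have "x = j \<or> x = j'" if xy: "T i x y" for x y
  proof (rule ccontr)
    assume "\<not> ?thesis"
    then have d: "distinct [x, j, j']" using j(1) by auto
    obtain i' where "i' \<noteq> i" using delete_a[of i] by fastforce
    moreover obtain a b c e where "a \<noteq> b" "T i' a c" "T i' b e" using degree_ge_2 by blast
    moreover obtain c' e' where "T i a c'" "T i b e'"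
      using distinct_3_cases[OF d, of a] distinct_3_cases[OF d, of b] j xy by metis
    ultimately show False using rectangle_ab by blast
  qed
  then show ?thesis using j unique_c by (intro exI[of _ j] exI[of _ j'] exI[of _ k] exI[of _ k']) blast
qed

lemma other_line:
  assumes "T i j k"
  obtains j' k' where "j' \<noteq> j" "k' \<noteq> k" "T i j' k'"
    "\<And>x y. T i x y \<Longrightarrow> x = j \<and> y = k \<or> x = j' \<and> y = k'"
proof -
  obtain a b c e where *: "a \<noteq> b" "T i a c" "T i b e"
    and **: "\<And>x y. T i x y \<Longrightarrow> x = a \<and> y = c \<or> x = b \<and> y = e"
    using degree_eq_2[of i] by auto
  have "c \<noteq> e" using * unique_b by blast
  show thesis using **[OF assms]
  proof
    assume "j = a \<and> k = c" then show thesis using that[of b e] * ** \<open>c \<noteq> e\<close> by auto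
  next
    assume "j = b \<and> k = e" then show thesis using that[of a c] * ** \<open>c \<noteq> e\<close> by auto
  qed
qed

text \<open>The three entries meet pairwise in the points labelled \<open>i\<close>,
  \<open>j\<close> and \<open>k'\<close>. Without triangles, the second entries through the three
  points of one entry would split the remaining labels, and the triple left over by a disjoint pair
  would be an entry.\<close>

lemma triangle:
  "\<exists>i i' j j' k k'. i \<noteq> i' \<and> j \<noteq> j' \<and> k \<noteq> k' \<and> T i j k \<and> T i j' k' \<and> T i' j k'"
proof (rule ccontr)
  assume "\<not> ?thesis"
  then have no: "False" if "i \<noteq> i'" "j \<noteq> j'" "k \<noteq> k'" "T i j k" "T i j' k'" "T i' j k'"
    for i i' j j' k k'
    using that by blast
  interpret b: cross_pattern "\<lambda>j i k. T i j k" by (rule swap_ab)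
  interpret c: cross_pattern "\<lambda>k i j. T i j k" by (rule cross_pattern.swap_ab[OF swap_bc])
  obtain i i1 i2 j j1 j2 k k1 k2 where d: "distinct [i,i1,i2]" "distinct [j,j1,j2]" "distinct [k,k1,k2]"
    and l: "T i1 j1 k1" "T i2 j2 k2" "\<not> T i j k" using delete_a[of 1] by blast
  obtain j3 k3 where n1: "j3 \<noteq> j1" "k3 \<noteq> k1" "T i1 j3 k3"
    by (rule other_line[OF l(1)]) blast
  obtain i3 k4 where n2: "i3 \<noteq> i1" "k4 \<noteq> k1" "T i3 j1 k4"
    and d2: "\<And>x y. T x j1 y \<Longrightarrow> x = i1 \<and> y = k1 \<or> x = i3 \<and> y = k4"
    by (rule b.other_line[OF l(1)]) blast
  obtain i4 j4 where n3: "i4 \<noteq> i1" "j4 \<noteq> j1" "T i4 j4 k1"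
    and d3: "\<And>x y. T x y k1 \<Longrightarrow> x = i1 \<and> y = j1 \<or> x = i4 \<and> y = j4"
    by (rule c.other_line[OF l(1)]) blast
  \<comment> \<open>Two neighbours of the entry \<open>(i1, j1, k1)\<close> that share a label would
    form a triangle with it.\<close>
  have "i3 \<noteq> i4" "j3 \<noteq> j4" "k3 \<noteq> k4"
    using no n1 n2 n3 l(1) by metis+
  have i34: "i3 = i \<and> i4 = i2 \<or> i3 = i2 \<and> i4 = i"
    using d(1) \<open>i3 \<noteq> i4\<close> n2 n3 by (intro distinct_3_pair[of i1]) auto
  have j34: "j3 = j \<and> j4 = j2 \<or> j3 = j2 \<and> j4 = j"
    using d(2) \<open>j3 \<noteq> j4\<close> n1 n3 by (intro distinct_3_pair[of j1]) auto
  have k34: "k3 = k \<and> k4 = k2 \<or> k3 = k2 \<and> k4 = k"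
    using d(3) \<open>k3 \<noteq> k4\<close> n1 n2 by (intro distinct_3_pair[of k1]) auto
  \<comment> \<open>Just one of the neighbours \<open>n2\<close>, \<open>n3\<close> lies in row
    \<open>i\<close>. The other entry of that row avoids \<open>j1\<close> and \<open>k1\<close>,
    since \<open>d2\<close> and \<open>d3\<close> list all entries with these labels.\<close>
  obtain x y where xy: "T i x y" "x \<noteq> j1" "y \<noteq> k1"
    using i34
  proof
    assume "i3 = i \<and> i4 = i2"
    then obtain x y where "T i x y" "x \<noteq> j1" using n2 by (metis other_line)
    moreover have "y \<noteq> k1" using calculation d3 \<open>i3 = i \<and> i4 = i2\<close> d(1) by auto
    ultimately show thesis using that by blast
  next
    assume "i3 = i2 \<and> i4 = i"
    then obtain x y where "T i x y" "y \<noteq> k1" using n3 by (metis other_line)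
    moreover have "x \<noteq> j1" using calculation d2 \<open>i3 = i2 \<and> i4 = i\<close> d(1) by auto
    ultimately show thesis using that by blast
  qed
  \<comment> \<open>Column \<open>j2\<close> already holds \<open>(i2, j2, k2)\<close> and a
    neighbour of \<open>(i1, j1, k1)\<close>, so a third entry would exceed degree two. The same
    argument excludes the symbol \<open>k2\<close>.\<close>
  have "x \<noteq> j2"
  proof
    assume "x = j2"
    obtain u v where "\<And>x y. T x j2 y \<Longrightarrow> x = i2 \<and> y = k2 \<or> x = u \<and> y = v"
      by (rule b.other_line[OF l(2)]) blast
    from this[of i y] this[of i1 k3] this[of i4 k1] show False
      using xy \<open>x = j2\<close> j34 n1 n3 d by auto
  qed
  moreover have "y \<noteq> k2"
  proof
    assume "y = k2"
    obtain u v where "\<And>x y. T x y k2 \<Longrightarrow> x = i2 \<and> y = j2 \<or> x = u \<and> y = v"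
      by (rule c.other_line[OF l(2)]) blast
    from this[of i x] this[of i1 j3] this[of i3 j1] show False
      using xy \<open>y = k2\<close> k34 n1 n2 d by auto
  qed
  ultimately have "x = j" "y = k"
    using distinct_3_cases[OF d(2), of x] distinct_3_cases[OF d(3), of y] xy by auto
  then show False using xy l(3) by simp
qed

end

section \<open>Lines in the plane\<close>

lemma line_eqI:
  assumes "is_line l" "is_line m" "x \<noteq> y" "x \<in> l" "y \<in> l" "x \<in> m" "y \<in> m"
  shows "l = m"
proof -
  have "affine hull {x, y} = n" if "is_line n" "x \<in> n" "y \<in> n" for n
  proof (rule affine_dim_equal)
    show "affine hull {x, y} \<subseteq> n" using that by (simp add: is_line_def hull_minimal)
    show "aff_dim (affine hull {x, y}) = aff_dim n"
      using that assms(3) by (simp add: is_line_def aff_dim_2)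
  qed (use that in \<open>auto simp: is_line_def\<close>)
  then show ?thesis using assms by blast
qed

lemma line_inter_card_le_3:
  assumes "finite P" "\<not> (\<exists>Q. Q \<subseteq> P \<and> card Q = 4 \<and> collinear Q)" "is_line l"
  shows "card (l \<inter> P) \<le> 3"
proof (rule ccontr)
  assume "\<not> ?thesis"
  then have "4 \<le> card (l \<inter> P)" by simp
  then obtain Q where Q: "Q \<subseteq> l \<inter> P" "card Q = 4"
    by (rule obtain_subset_with_card_n)
  then have "aff_dim Q \<le> aff_dim l" by (intro aff_dim_subset) blast
  then have "collinear Q" using assms(3) by (simp add: collinear_aff_dim is_line_def)
  then show False using Q assms(2) by blast
qed

text \<open>The sizes add up to at most 9, so at most one unit is lost, either to a smaller set or
  to one shared point.\<close>

lemma disjoint_pair_of_three: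
  assumes "finite U" "finite V" "finite W" "card U \<le> 3" "card V \<le> 3" "card W \<le> 3" "card (U \<union> V \<union> W) = 8"
  shows "card U = 3 \<and> card V = 3 \<and> U \<inter> V = {} \<or> card U = 3 \<and> card W = 3 \<and> U \<inter> W = {} \<or>
    card V = 3 \<and> card W = 3 \<and> V \<inter> W = {}"
proof -
  have *: "card X = 3 \<and> card Y = 3 \<and> X \<inter> Y = {}"
    if "card (X \<union> Y) \<ge> 6" "finite X" "finite Y" "card X \<le> 3" "card Y \<le> 3" for X Y :: "'a set"
  proof -
    have "card X = 3" "card Y = 3" "card (X \<inter> Y) = 0" using that card_Un_Int[of X Y] by linarith+
    then show ?thesis using that by simp
  qed
  have "card (U \<union> V) \<ge> 6 \<or> card (U \<union> W) \<ge> 6 \<or> card (V \<union> W) \<ge> 6"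
  proof (rule ccontr)
    assume n: "\<not> ?thesis"
    have "U \<union> V \<union> W = (U \<union> W) \<union> V" "U \<union> V \<union> W = (V \<union> W) \<union> U" by auto
    then have "card (U \<union> V) + card W \<ge> 8" "card (U \<union> W) + card V \<ge> 8" "card (V \<union> W) + card U \<ge> 8"
      using card_Un_le[of "U \<union> V" W] card_Un_le[of "U \<union> W" V] card_Un_le[of "V \<union> W" U] assms(7) by auto
    \<comment> \<open>If every pairwise union had at most 5 elements, all sets would have size 3 and
      all pairwise unions size 5. Then \<open>W\<close> meets \<open>U\<close>, yet it must be
      disjoint from \<open>U \<union> V\<close> to reach 8.\<close>
    then have "card (U \<inter> W) = 1" "card ((U \<union> V) \<inter> W) = 0"
      using n assms(4-7) card_Un_Int[OF assms(1,3)] card_Un_Int[of "U \<union> V" W] assms(1-3)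
      by (simp_all del: card_0_eq card_eq_0_iff)
    moreover have "U \<inter> W \<subseteq> (U \<union> V) \<inter> W" by auto
    ultimately show False using assms by (metis card_mono finite_Int finite_UnI not_one_le_zero)
  qed
  then show ?thesis using * assms by blast
qed

section \<open>Three covering lines with labelled points\<close>

definition on_line :: "(3 \<Rightarrow> plane) \<Rightarrow> (3 \<Rightarrow> plane) \<Rightarrow> (3 \<Rightarrow> plane) \<Rightarrow> 3 \<Rightarrow> 3 \<Rightarrow> 3 \<Rightarrow> bool" where
  "on_line a b c i j k \<longleftrightarrow> (\<exists>l. is_line l \<and> {a i, b j, c k} \<subseteq> l)"

locale labelled_cover =
  fixes P A B C :: "plane set" and a b c :: "3 \<Rightarrow> plane"
  assumes shattered: "shatters F3 P"
    and card_le_3: "is_line l \<Longrightarrow> card (l \<inter> P) \<le> 3"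
    and lines: "is_line A" "is_line B" "is_line C"
    and inj: "inj a" "inj b" "inj c"
    and range: "range a = A \<inter> P" "range b = B \<inter> P" "range c = C \<inter> P"
    and disj: "A \<inter> B \<inter> P = {}" "A \<inter> C \<inter> P = {}" "B \<inter> C \<inter> P = {}"
    and cover: "P \<subseteq> A \<union> B \<union> C"
begin

lemma swap_ab: "labelled_cover P B A C b a c"
  by unfold_locales (use shattered card_le_3 lines inj range disj cover in auto)

lemma swap_bc: "labelled_cover P A C B a c b"
  by unfold_locales (use shattered card_le_3 lines inj range disj cover in auto)

lemma P_eq: "P = range a \<union> range b \<union> range c"
  using range cover by auto

lemma finite_P: "finite P" using P_eq by simp

lemma in_P: "a i \<in> P" "b j \<in> P" "c k \<in> P" "a i \<in> A" "b j \<in> B" "c k \<in> C"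
  using range by auto

lemma distinct_labels: "a i = a i' \<longleftrightarrow> i = i'" "b j = b j' \<longleftrightarrow> j = j'" "c k = c k' \<longleftrightarrow> k = k'"
  "a i \<noteq> b j" "a i \<noteq> c k" "b j \<noteq> c k" "b j \<noteq> a i" "c k \<noteq> a i" "c k \<noteq> b j"
  using inj disj in_P by (auto simp: inj_eq disjoint_iff) metis+

lemma not_in: "a i \<notin> B" "a i \<notin> C" "b j \<notin> A" "b j \<notin> C" "c k \<notin> A" "c k \<notin> B"
  using disj in_P by blast+

lemma card_P: "card P = 9"
proof -
  have "card (range a) = 3" "card (range b) = 3" "card (range c) = 3"
    using inj by (simp_all add: card_image)
  moreover have "range a \<inter> range b = {}" "(range a \<union> range b) \<inter> range c = {}"
    using distinct_labels by auto
  ultimately show ?thesis by (simp add: P_eq card_Un_disjoint)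
qed

lemma line_eq_A: "is_line l \<Longrightarrow> a i \<in> l \<Longrightarrow> a i' \<in> l \<Longrightarrow> i \<noteq> i' \<Longrightarrow> l = A"
  using line_eqI[of l A "a i" "a i'"] lines(1) in_P(4) distinct_labels(1) by simp

lemma third_point:
  assumes "on_line a b c i j k" "is_line l" "a i \<in> l" "b j \<in> l"
  shows "c k \<in> l"
proof -
  obtain m where m: "is_line m" "a i \<in> m" "b j \<in> m" "c k \<in> m"
    using assms(1) by (auto simp: on_line_def)
  then have "m = l" using line_eqI[OF m(1) assms(2) distinct_labels(4)] assms(3,4) by blast
  then show ?thesis using m by simp
qed

lemma cover_subset:
  assumes "Z \<subseteq> P"
  obtains X Y W where "is_line X" "is_line Y" "is_line W" "(X \<union> Y \<union> W) \<inter> P = Z"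
  using assms shattered unfolding shatters_def F3_def by blast

lemma unique_c:
  assumes "on_line a b c i j k" "on_line a b c i j k'"
  shows "k = k'"
proof (rule ccontr)
  assume "k \<noteq> k'"
  obtain l where l: "is_line l" "a i \<in> l" "b j \<in> l" "c k \<in> l" using assms by (auto simp: on_line_def)
  moreover have "c k' \<in> l" using third_point[OF assms(2)] l by blast
  ultimately have "l = C" using line_eqI[of l C "c k" "c k'"] lines(3) in_P(6) distinct_labels(3) \<open>k \<noteq> k'\<close> by simp
  then show False using l not_in by auto
qed

lemma rectangle_ab:
  assumes ne: "i \<noteq> i'" "j \<noteq> j'" and on: "on_line a b c i j k1" "on_line a b c i j' k2"
    "on_line a b c i' j k3" "on_line a b c i' j' k4"
  shows False
proof -
  interpret s: labelled_cover P B A C b a c by (rule swap_ab)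
  let ?Z = "{a i, a i', b j, b j'}"
  obtain X Y W where XYW: "is_line X" "is_line Y" "is_line W" and Z: "(X \<union> Y \<union> W) \<inter> P = ?Z"
    using cover_subset[of ?Z] in_P by auto
  have "?Z \<subseteq> X \<union> Y \<union> W" using Z by blast
  \<comment> \<open>Pigeonhole: three lines cover four points.\<close>
  then obtain U where U: "U = X \<or> U = Y \<or> U = W" "a i \<in> U \<and> a i' \<in> U \<or> b j \<in> U \<and> b j' \<in> U \<or>
    a i \<in> U \<and> b j \<in> U \<or> a i \<in> U \<and> b j' \<in> U \<or> a i' \<in> U \<and> b j \<in> U \<or> a i' \<in> U \<and> b j' \<in> U"
    by (simp only: insert_subset Un_iff) metis
  have l: "is_line U" and sub: "U \<inter> P \<subseteq> ?Z" using U XYW Z by auto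
  have "c k \<notin> U" for k using sub distinct_labels in_P by auto
  then have "\<not> (a i \<in> U \<and> b j \<in> U)" "\<not> (a i \<in> U \<and> b j' \<in> U)" "\<not> (a i' \<in> U \<and> b j \<in> U)"
    "\<not> (a i' \<in> U \<and> b j' \<in> U)"
    using third_point l on by blast+
  \<comment> \<open>A pair on \<open>A\<close> or on \<open>B\<close> forces \<open>U\<close> to be
    that line, which contains a third point of \<open>P\<close> outside \<open>?Z\<close>.\<close>
  moreover obtain i'' j'' where "distinct [i'', i, i']" "distinct [j'', j, j']"
    using third_index ne by meson
  then have "a i'' \<notin> U" "b j'' \<notin> U" using sub distinct_labels in_P by auto
  then have "\<not> (a i \<in> U \<and> a i' \<in> U)" "\<not> (b j \<in> U \<and> b j' \<in> U)"
    using line_eq_A s.line_eq_A l ne in_P by blast+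
  ultimately show False using U(2) by blast
qed

text \<open>A line other than \<open>A\<close>, \<open>B\<close>, \<open>C\<close> meets each of
  them at most once, so three points of \<open>P\<close> on it must be spread over all
  three.\<close>

lemma three_point_line:
  assumes "is_line l" "card (l \<inter> P) = 3" "l \<noteq> A" "l \<noteq> B" "l \<noteq> C"
  obtains i j k where "l \<inter> P = {a i, b j, c k}"
proof -
  have *: "card (l \<inter> m \<inter> P) \<le> 1" if "is_line m" "l \<noteq> m" for m
    using that assms(1) line_eqI[of l m] finite_P by (auto simp: card_le_Suc0_iff_eq)
  have "l \<inter> P = (l \<inter> A \<inter> P) \<union> (l \<inter> B \<inter> P) \<union> (l \<inter> C \<inter> P)" using cover by auto
  then have "3 \<le> card (l \<inter> A \<inter> P) + card (l \<inter> B \<inter> P) + card (l \<inter> C \<inter> P)"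
    using assms(2) card_Un_le[of "l \<inter> A \<inter> P \<union> l \<inter> B \<inter> P" "l \<inter> C \<inter> P"] card_Un_le[of "l \<inter> A \<inter> P" "l \<inter> B \<inter> P"]
    by simp
  then have "card (l \<inter> A \<inter> P) = 1" "card (l \<inter> B \<inter> P) = 1" "card (l \<inter> C \<inter> P) = 1"
    using *[of A] *[of B] *[of C] lines assms by auto
  then obtain x y z where xyz: "l \<inter> A \<inter> P = {x}" "l \<inter> B \<inter> P = {y}" "l \<inter> C \<inter> P = {z}"
    by (auto simp: card_1_singleton_iff)
  then have "x \<in> range a" "y \<in> range b" "z \<in> range c" unfolding range by auto
  moreover have "l \<inter> P = {x, y, z}" using xyz cover by auto
  ultimately show thesis using that by blast
qed

lemma delete_a:
  "\<exists>i1 i2 j1 j2 j k1 k2 k. distinct [i, i1, i2] \<and> distinct [j, j1, j2] \<and> distinct [k, k1, k2] \<and>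
    on_line a b c i1 j1 k1 \<and> on_line a b c i2 j2 k2 \<and> \<not> on_line a b c i j k"
proof -
  \<comment> \<open>Eight points remain, so two of the three lines are full and disjoint in
    \<open>P\<close>; these are renamed \<open>U\<close> and \<open>V\<close>.\<close>
  obtain U V W where l: "is_line U" "is_line V" "is_line W" and Z: "(U \<union> V \<union> W) \<inter> P = P - {a i}"
    and UV: "card (U \<inter> P) = 3" "card (V \<inter> P) = 3" "U \<inter> V \<inter> P = {}"
  proof -
    obtain X Y W where l: "is_line X" "is_line Y" "is_line W" and Z: "(X \<union> Y \<union> W) \<inter> P = P - {a i}"
      using cover_subset[of "P - {a i}"] by auto
    have "X \<inter> P \<union> Y \<inter> P \<union> W \<inter> P = P - {a i}" using Z by auto
    then have "card (X \<inter> P \<union> Y \<inter> P \<union> W \<inter> P) = 8" using card_P in_P by simp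
    moreover have "(X \<inter> P) \<inter> (Y \<inter> P) = X \<inter> Y \<inter> P" for X Y :: "plane set" by auto
    ultimately have
      "card (X \<inter> P) = 3 \<and> card (Y \<inter> P) = 3 \<and> X \<inter> Y \<inter> P = {} \<or>
       card (X \<inter> P) = 3 \<and> card (W \<inter> P) = 3 \<and> X \<inter> W \<inter> P = {} \<or>
       card (Y \<inter> P) = 3 \<and> card (W \<inter> P) = 3 \<and> Y \<inter> W \<inter> P = {}"
      using disjoint_pair_of_three[of "X \<inter> P" "Y \<inter> P" "W \<inter> P"] finite_P l[THEN card_le_3] by simp
    moreover have "(X \<union> W \<union> Y) \<inter> P = P - {a i}" "(Y \<union> W \<union> X) \<inter> P = P - {a i}" using Z by auto
    ultimately show thesis using that l Z by metis
  qed
  have ai: "a i \<notin> U" "a i \<notin> V" "a i \<notin> W" using Z in_P by auto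
  have rest: "p \<in> W" if "p \<in> P" "p \<noteq> a i" "p \<notin> U" "p \<notin> V" for p using that Z by auto
  have not_A: "U \<noteq> A" "V \<noteq> A" using ai in_P by auto
  \<comment> \<open>Otherwise \<open>W\<close> would have to contain the other two points of
    \<open>A\<close>, hence also \<open>a i\<close>.\<close>
  have not_BC: "\<not> (U = B \<and> V = C \<or> U = C \<and> V = B)"
  proof
    assume UV_BC: "U = B \<and> V = C \<or> U = C \<and> V = B"
    obtain i1 i2 where d: "distinct [i, i1, i2]" by (rule other_indices)
    then have "a i1 \<in> W" "a i2 \<in> W" using UV_BC rest in_P not_in distinct_labels by auto
    then have "W = A" using line_eq_A l(3) d by auto
    then show False using ai in_P by auto
  qed
  \<comment> \<open>If one line is \<open>B\<close> or \<open>C\<close>, the other is a transversal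
    by \<open>not_BC\<close>, so it meets that line in \<open>P\<close>, against
    disjointness.\<close>
  have not_B_or_C: "X \<noteq> B \<and> X \<noteq> C" if XY: "X = U \<and> Y = V \<or> X = V \<and> Y = U" for X Y
  proof
    have Y: "is_line Y" "card (Y \<inter> P) = 3" "Y \<noteq> A" "X \<inter> Y \<inter> P = {}"
      using XY l UV not_A by (auto simp: Int_commute)
    show "X \<noteq> B"
    proof
      assume "X = B"
      then have disj_Y: "b x \<notin> Y" for x using Y(4) in_P(2,5)[of x] by blast
      then have "Y \<noteq> B" using in_P by blast
      moreover have "Y \<noteq> C" using XY not_BC \<open>X = B\<close> by blast
      ultimately obtain i j k where "Y \<inter> P = {a i, b j, c k}" using three_point_line[OF Y(1-3)] by blast
      then show False using disj_Y by blast
    qed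
    show "X \<noteq> C"
    proof
      assume "X = C"
      then have disj_Y: "c x \<notin> Y" for x using Y(4) in_P(3,6)[of x] by blast
      then have "Y \<noteq> C" using in_P by blast
      moreover have "Y \<noteq> B" using XY not_BC \<open>X = C\<close> by blast
      ultimately obtain i j k where "Y \<inter> P = {a i, b j, c k}" using three_point_line[OF Y(1-3)] by blast
      then show False using disj_Y by blast
    qed
  qed
  have "U \<notin> {A, B, C}" "V \<notin> {A, B, C}" using not_A not_B_or_C by blast+
  then obtain i1 j1 k1 i2 j2 k2 where t: "U \<inter> P = {a i1, b j1, c k1}" "V \<inter> P = {a i2, b j2, c k2}"
    using three_point_line[OF l(1) UV(1)] three_point_line[OF l(2) UV(2)] by (metis insert_iff)
  have "i \<noteq> i1" "i \<noteq> i2" using t ai by auto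
  moreover have ne: "i1 \<noteq> i2" "j1 \<noteq> j2" "k1 \<noteq> k2" using UV(3) t by auto
  moreover obtain j k where jk: "distinct [j, j1, j2]" "distinct [k, k1, k2]" using third_index ne by meson
  moreover have "on_line a b c i1 j1 k1" "on_line a b c i2 j2 k2" using l t by (auto simp: on_line_def)
  \<comment> \<open>\<open>W\<close> has to contain the leftover points \<open>b j\<close> and
    \<open>c k\<close>; collinearity would put the deleted point \<open>a i\<close> on
    \<open>W\<close>.\<close>
  moreover have "\<not> on_line a b c i j k"
  proof
    assume "on_line a b c i j k"
    then obtain m where m: "is_line m" "a i \<in> m" "b j \<in> m" "c k \<in> m" by (auto simp: on_line_def)
    have "b j \<notin> U \<inter> P" "b j \<notin> V \<inter> P" "c k \<notin> U \<inter> P" "c k \<notin> V \<inter> P"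
      unfolding t using jk distinct_labels by auto
    then have "b j \<in> W" "c k \<in> W" using rest[of "b j"] rest[of "c k"] in_P(2,3) distinct_labels(7,8) by auto
    then have "W = m" using line_eqI[OF l(3) m(1) distinct_labels(6)] m by blast
    then show False using m ai by blast
  qed
  ultimately have "distinct [i, i1, i2] \<and> distinct [j, j1, j2] \<and> distinct [k, k1, k2] \<and>
    on_line a b c i1 j1 k1 \<and> on_line a b c i2 j2 k2 \<and> \<not> on_line a b c i j k" by simp
  then show ?thesis by (intro exI)
qed

section \<open>Cross-lines as entries of the pattern\<close>

lemma cross_line_of_on_line:
  assumes "is_line l" "a i \<in> l" "b j \<in> l" "c k \<in> l"
  shows "cross_line P {A, B, C} l"
proof -
  have "l \<inter> A \<inter> P = {a i}" "l \<inter> B \<inter> P = {b j}" "l \<inter> C \<inter> P = {c k}"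
    using assms lines in_P not_in line_eqI[of l A _ "a i"] line_eqI[of l B _ "b j"] line_eqI[of l C _ "c k"]
    by blast+
  then show ?thesis using assms by (simp add: cross_line_def)
qed

lemma cross_line_labels:
  assumes "cross_line P {A, B, C} l"
  obtains i j k where "a i \<in> l" "b j \<in> l" "c k \<in> l"
proof -
  have "card (l \<inter> A \<inter> P) = 1" "card (l \<inter> B \<inter> P) = 1" "card (l \<inter> C \<inter> P) = 1"
    using assms by (auto simp: cross_line_def)
  then have "l \<inter> A \<inter> P \<noteq> {}" "l \<inter> B \<inter> P \<noteq> {}" "l \<inter> C \<inter> P \<noteq> {}" by force+
  then have "l \<inter> range a \<noteq> {}" "l \<inter> range b \<noteq> {}" "l \<inter> range c \<noteq> {}" unfolding range by blast+
  then show thesis using that by blast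
qed

lemma cross_pattern_on_line: "cross_pattern (on_line a b c)"
proof -
  interpret acb: labelled_cover P A C B a c b by (rule swap_bc)
  interpret bac: labelled_cover P B A C b a c by (rule swap_ab)
  interpret cab: labelled_cover P C A B c a b by (rule acb.swap_ab)
  interpret bca: labelled_cover P B C A b c a by (rule bac.swap_bc)
  \<comment> \<open>These equations bring the facts from the permuted covers back to the original
    order of roles.\<close>
  have perm: "on_line a c b i k j = on_line a b c i j k" "on_line b a c j i k = on_line a b c i j k"
    "on_line c a b k i j = on_line a b c i j k" "on_line b c a j k i = on_line a b c i j k" for i j k
    by (simp_all add: on_line_def conj_ac)
  show ?thesis
  proof
    show "i = i'" if "on_line a b c i j k" "on_line a b c i' j k" for i i' j k
      using bca.unique_c that unfolding perm by blast
    show "j = j'" if "on_line a b c i j k" "on_line a b c i j' k" for i j j' k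
      using acb.unique_c that unfolding perm by blast
    show "k = k'" if "on_line a b c i j k" "on_line a b c i j k'" for i j k k'
      using unique_c that by blast
  next
    fix i j k :: 3
    show "\<exists>i1 i2 j1 j2 j k1 k2 k. distinct [i, i1, i2] \<and> distinct [j, j1, j2] \<and>
      distinct [k, k1, k2] \<and> on_line a b c i1 j1 k1 \<and> on_line a b c i2 j2 k2 \<and> \<not> on_line a b c i j k"
      by (rule delete_a)
    show "\<exists>j1 j2 i1 i2 i k1 k2 k. distinct [j, j1, j2] \<and> distinct [i, i1, i2] \<and>
      distinct [k, k1, k2] \<and> on_line a b c i1 j1 k1 \<and> on_line a b c i2 j2 k2 \<and> \<not> on_line a b c i j k"
      using bac.delete_a[of j] unfolding perm .
    show "\<exists>k1 k2 i1 i2 i j1 j2 j. distinct [k, k1, k2] \<and> distinct [i, i1, i2] \<and>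
      distinct [j, j1, j2] \<and> on_line a b c i1 j1 k1 \<and> on_line a b c i2 j2 k2 \<and> \<not> on_line a b c i j k"
      using cab.delete_a[of k] unfolding perm .
  next
    show False if "i \<noteq> i'" "j \<noteq> j'" "on_line a b c i j k1" "on_line a b c i j' k2"
      "on_line a b c i' j k3" "on_line a b c i' j' k4" for i i' j j' k1 k2 k3 k4
      using rectangle_ab that by blast
    show False if "i \<noteq> i'" "k \<noteq> k'" "on_line a b c i j1 k" "on_line a b c i j2 k'"
      "on_line a b c i' j3 k" "on_line a b c i' j4 k'" for i i' k k' j1 j2 j3 j4
      using acb.rectangle_ab that unfolding perm by blast
    show False if "j \<noteq> j'" "k \<noteq> k'" "on_line a b c i1 j k" "on_line a b c i2 j k'"
      "on_line a b c i3 j' k" "on_line a b c i4 j' k'" for j j' k k' i1 i2 i3 i4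
      using bca.rectangle_ab that unfolding perm by blast
  qed
qed

lemma line_of_on_line:
  assumes "on_line a b c i j k"
  obtains l where "is_line l" "a i \<in> l" "b j \<in> l" "c k \<in> l" "cross_line P {A, B, C} l"
  using assms cross_line_of_on_line by (auto simp: on_line_def)

lemma cross_line_meets_once:
  assumes "cross_line P {A, B, C} l"
  shows "a i \<in> l \<Longrightarrow> a i' \<in> l \<Longrightarrow> i = i'" "b j \<in> l \<Longrightarrow> b j' \<in> l \<Longrightarrow> j = j'"
proof -
  obtain i0 j0 k0 where l: "is_line l" "a i0 \<in> l" "b j0 \<in> l" "c k0 \<in> l"
    using assms cross_line_labels by (metis cross_line_def)
  interpret s: labelled_cover P B A C b a c by (rule swap_ab)
  show "i = i'" if "a i \<in> l" "a i' \<in> l" using line_eq_A[of l i i'] l that not_in(3) by blast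
  show "j = j'" if "b j \<in> l" "b j' \<in> l" using s.line_eq_A[of l j j'] l that not_in(1) by blast
qed

lemma card_cross_lines_a: "card {l. point_cross_line P {A, B, C} (a i) l} = 2"
proof -
  interpret cross_pattern "on_line a b c" by (rule cross_pattern_on_line)
  obtain j j' k k' where "j \<noteq> j'" and on: "on_line a b c i j k" "on_line a b c i j' k'"
    and all: "\<And>x y. on_line a b c i x y \<Longrightarrow> (x, y) = (j, k) \<or> (x, y) = (j', k')"
    using degree_eq_2[of i] by blast
  obtain l where l: "is_line l" "a i \<in> l" "b j \<in> l" "cross_line P {A, B, C} l"
    using line_of_on_line[OF on(1)] by blast
  obtain l' where l': "is_line l'" "a i \<in> l'" "b j' \<in> l'" "cross_line P {A, B, C} l'"
    using line_of_on_line[OF on(2)] by blast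
  have "m = l \<or> m = l'" if m: "cross_line P {A, B, C} m" "a i \<in> m" for m
  proof -
    obtain x y where xy: "b x \<in> m" "c y \<in> m" using cross_line_labels[OF m(1)] by blast
    have "is_line m" using m(1) by (simp add: cross_line_def)
    then have "on_line a b c i x y" using m xy by (auto simp: on_line_def)
    then have "x = j \<or> x = j'" using all by blast
    then show ?thesis
      using line_eqI[OF \<open>is_line m\<close> l(1) distinct_labels(4)] line_eqI[OF \<open>is_line m\<close> l'(1) distinct_labels(4)]
        m xy l l' by blast
  qed
  then have "{m. point_cross_line P {A, B, C} (a i) m} = {l, l'}"
    using l l' by (auto simp: point_cross_line_def)
  moreover have "l \<noteq> l'" using cross_line_meets_once(2)[OF l(4)] l l' \<open>j \<noteq> j'\<close> by blast
  ultimately show ?thesis by simp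
qed

lemma card_cross_lines:
  assumes "x \<in> P"
  shows "card {l. point_cross_line P {A, B, C} x l} = 2"
proof -
  interpret acb: labelled_cover P A C B a c b by (rule swap_bc)
  interpret bac: labelled_cover P B A C b a c by (rule swap_ab)
  interpret cab: labelled_cover P C A B c a b by (rule acb.swap_ab)
  have "{B, A, C} = {A, B, C}" "{C, A, B} = {A, B, C}" by auto
  then show ?thesis
    using assms card_cross_lines_a bac.card_cross_lines_a cab.card_cross_lines_a unfolding P_eq by auto
qed

lemma cross_line_triangle:
  "\<exists>y\<in>P. \<exists>ly ly' l. point_cross_line P {A, B, C} y ly \<and> point_cross_line P {A, B, C} y ly' \<and>
    ly \<noteq> ly' \<and> cross_line P {A, B, C} l \<and> y \<notin> l \<and> l \<inter> ly \<inter> P \<noteq> {} \<and> l \<inter> ly' \<inter> P \<noteq> {}"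
proof -
  interpret cross_pattern "on_line a b c" by (rule cross_pattern_on_line)
  obtain i i' j j' k k' where ne: "i \<noteq> i'" "j \<noteq> j'"
    and on: "on_line a b c i j k" "on_line a b c i j' k'" "on_line a b c i' j k'"
    using triangle by blast
  obtain l1 where l1: "a i \<in> l1" "b j \<in> l1" "cross_line P {A, B, C} l1"
    using line_of_on_line[OF on(1)] by blast
  obtain l2 where l2: "a i \<in> l2" "b j' \<in> l2" "c k' \<in> l2" "cross_line P {A, B, C} l2"
    using line_of_on_line[OF on(2)] by blast
  obtain l3 where l3: "a i' \<in> l3" "b j \<in> l3" "c k' \<in> l3" "cross_line P {A, B, C} l3"
    using line_of_on_line[OF on(3)] by blast
  have "l1 \<noteq> l2" using cross_line_meets_once(2)[OF l1(3)] l1 l2 ne by blast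
  moreover have "a i \<notin> l3" using cross_line_meets_once(1)[OF l3(4)] l3 ne by blast
  \<comment> \<open>With \<open>y\<close> taken as \<open>a i\<close>, the meeting points are
    \<open>b j\<close> and \<open>c k'\<close>.\<close>
  moreover have "l3 \<inter> l1 \<inter> P \<noteq> {}" "l3 \<inter> l2 \<inter> P \<noteq> {}" using l1 l2 l3 in_P by blast+
  ultimately show ?thesis using l1 l2 l3 in_P(1)[of i] unfolding point_cross_line_def by blast
qed

end

section \<open>From the hypotheses to labelled covers\<close>

lemma obtain_labelling:
  fixes X :: "'a set"
  assumes "card X = 3"
  obtains a :: "3 \<Rightarrow> 'a" where "inj a" "range a = X"
proof -
  have "finite X" using assms by (metis card.infinite zero_neq_numeral)
  then obtain a :: "3 \<Rightarrow> 'a" where "bij_betw a UNIV X"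
    using finite_same_card_bij[of "UNIV :: 3 set" X] assms by auto
  then show thesis using that by (auto simp: bij_betw_def)
qed

lemma lines_cover_card_ge_3:
  assumes "card P = 9" and le: "\<And>l. is_line l \<Longrightarrow> card (l \<inter> P) \<le> 3" and "lines_cover \<S> P"
  shows "3 \<le> card \<S>"
proof -
  have "P = (\<Union>l\<in>\<S>. l \<inter> P)" "finite \<S>" using assms(3) by (auto simp: lines_cover_def)
  then have "card P \<le> (\<Sum>l\<in>\<S>. card (l \<inter> P))" by (metis card_UN_le)
  also have "\<dots> \<le> (\<Sum>l\<in>\<S>. 3)"
    by (rule sum_mono) (use assms(3) le in \<open>auto simp: lines_cover_def\<close>)
  finally show ?thesis using assms(1) by simp
qed

text \<open>Nine points with at most three on each line force equality in the count: every line is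
  full and no point of \<open>P\<close> is shared. In particular, the three lines are
  distinct.\<close>

lemma labelled_cover_of_lines_cover:
  assumes "card P = 9" "shatters F3 P" and le: "\<And>l. is_line l \<Longrightarrow> card (l \<inter> P) \<le> 3"
    and cov: "lines_cover {A, B, C} P"
  obtains a b c where "labelled_cover P A B C a b c"
proof -
  have fin: "finite P" using assms(1) by (metis card.infinite zero_neq_numeral)
  have l: "is_line A" "is_line B" "is_line C" and P: "P = (A \<inter> P \<union> B \<inter> P) \<union> C \<inter> P"
    using cov by (auto simp: lines_cover_def)
  have "card (A \<inter> P) + card (B \<inter> P) = card (A \<inter> P \<union> B \<inter> P) + card (A \<inter> P \<inter> (B \<inter> P))"
    by (rule card_Un_Int) (use fin in auto)
  moreover have "card (A \<inter> P \<union> B \<inter> P) + card (C \<inter> P) = 9 + card ((A \<inter> P \<union> B \<inter> P) \<inter> (C \<inter> P))"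
    using card_Un_Int[of "A \<inter> P \<union> B \<inter> P" "C \<inter> P"] fin P assms(1) by simp
  ultimately have c: "card (A \<inter> P) = 3" "card (B \<inter> P) = 3" "card (C \<inter> P) = 3"
    and d: "card (A \<inter> P \<inter> (B \<inter> P)) = 0" "card ((A \<inter> P \<union> B \<inter> P) \<inter> (C \<inter> P)) = 0"
    using l[THEN le] by linarith+
  obtain a :: "3 \<Rightarrow> plane" where a: "inj a" "range a = A \<inter> P" using obtain_labelling[OF c(1)] .
  obtain b :: "3 \<Rightarrow> plane" where b: "inj b" "range b = B \<inter> P" using obtain_labelling[OF c(2)] .
  obtain c :: "3 \<Rightarrow> plane" where c: "inj c" "range c = C \<inter> P" using obtain_labelling[OF c(3)] .
  have "A \<inter> P \<inter> (B \<inter> P) = {}" "(A \<inter> P \<union> B \<inter> P) \<inter> (C \<inter> P) = {}" using d fin by simp_all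
  then have disj: "A \<inter> B \<inter> P = {}" "A \<inter> C \<inter> P = {}" "B \<inter> C \<inter> P = {}" by blast+
  have "labelled_cover P A B C a b c"
    by unfold_locales (fact assms(2) le l a b c disj | use P in blast)+
  then show thesis by (rule that)
qed

theorem proposition6p19:
  fixes P :: "(real ^ 2) set"
  assumes "card P = 9"
    and "shatters F3 P"
    and "\<not> (\<exists>Q. Q \<subseteq> P \<and> card Q = 4 \<and> collinear Q)"
  shows "property_O P \<and> property_B1 P \<and> property_B2 P"
proof -
  have "finite P" using assms(1) by (metis card.infinite zero_neq_numeral)
  then have le: "card (l \<inter> P) \<le> 3" if "is_line l" for l
    using line_inter_card_le_3[OF _ assms(3) that] by blast
  \<comment> \<open>Shattering applied to \<open>P\<close> itself gives (O).\<close>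
  obtain X Y W where "is_line X" "is_line Y" "is_line W" "P = (X \<union> Y \<union> W) \<inter> P"
    using assms(2) unfolding shatters_def F3_def by blast
  then have cover: "lines_cover {X, Y, W} P" by (auto simp: lines_cover_def)
  moreover have card_XYW: "card {X, Y, W} \<le> 3" by (simp add: card_insert_if)
  ultimately have O: "property_O P" by (auto simp: property_O_def)
  have "min_lines P = 3"
    unfolding min_lines_def
  proof (rule Least_equality)
    show "\<exists>\<S>. lines_cover \<S> P \<and> card \<S> = 3"
      \<comment> \<open>The lines \<open>X\<close>, \<open>Y\<close>, \<open>W\<close> might
        coincide a priori; the lower bound shows that they do not.\<close>
      using cover card_XYW lines_cover_card_ge_3[OF assms(1) le cover] by (meson le_antisym)
    show "3 \<le> n" if "\<exists>\<S>. lines_cover \<S> P \<and> card \<S> = n" for n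
      using that lines_cover_card_ge_3[OF assms(1) le] by blast
  qed
  moreover have "L ` {1..3} = {L 1, L 2, L 3}" for L :: "nat \<Rightarrow> plane set"
    by (simp add: numeral_eq_Suc atLeastAtMostSuc_conv insert_commute)
  ultimately have img: "L ` {1..min_lines P} = {L 1, L 2, L 3}" for L :: "nat \<Rightarrow> plane set" by simp
  have "property_B1 P"
    unfolding property_B1_def img
    by (metis labelled_cover.card_cross_lines labelled_cover_of_lines_cover[OF assms(1,2) le])
  moreover have "property_B2 P"
    unfolding property_B2_def img
  proof (intro allI impI)
    fix L :: "nat \<Rightarrow> plane set"
    assume "lines_cover {L 1, L 2, L 3} P"
    then obtain a b c where "labelled_cover P (L 1) (L 2) (L 3) a b c"
      by (metis labelled_cover_of_lines_cover[OF assms(1,2) le])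
    then show "\<exists>y\<in>P. \<exists>ly ly' l. point_cross_line P {L 1, L 2, L 3} y ly \<and>
      point_cross_line P {L 1, L 2, L 3} y ly' \<and> ly \<noteq> ly' \<and> cross_line P {L 1, L 2, L 3} l \<and>
      y \<notin> l \<and> l \<inter> ly \<inter> P \<noteq> {} \<and> l \<inter> ly' \<inter> P \<noteq> {}"
      by (rule labelled_cover.cross_line_triangle)
  qed
  ultimately show ?thesis using O by blast
qed

end
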